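(* There exist absolute constants $c,C>0$ such that the following holds. Let $A\in\mathbb{R}^{m\times n}$ be a random matrix whose columns are drawn independently from a distribution $\mathcal{D}$ on $\mathbb{R}^m$ such that the marginal of each coordinate is sub-Gaussian with mean $0$ and variance parameter $\sigma^2$. If $n\le m\le 2^{c\sqrt{n}}$, then with probability at least $1-1/m^2$, \[\mathrm{disc}(A)\le C\,\sigma\sqrt{n\log(2m/n)}.\]
   Context: A random variable $X$ with $\mathbb{E}X=0$ is sub-Gaussian with variance $\sigma^2$ if $\mathbb{E}(e^{sX})\le e^{\sigma^2s^2/2}$ for all $s\in\mathbb{R}$. For $A\in\mathbb{R}^{m\times n}$, $\mathrm{disc}(A)=\min_{x\in\{-1,1\}^n}\|Ax\|_\infty$. *)

theory Defs
  imports "HOL-Probability.Probability"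
begin

text \<open>
  The integrability of \<open>exp (s * X)\<close> expresses that the moment generating function is finite;
  it has to be stated because the Bochner integral of a non-integrable function is 0.
\<close>

definition sub_gaussian :: "'a measure \<Rightarrow> ('a \<Rightarrow> real) \<Rightarrow> real \<Rightarrow> bool" where
  "sub_gaussian M X v \<longleftrightarrow>
     integrable M X \<and> (\<integral>\<omega>. X \<omega> \<partial>M) = 0 \<and>
     (\<forall>s::real. integrable M (\<lambda>\<omega>. exp (s * X \<omega>)) \<and>
                (\<integral>\<omega>. exp (s * X \<omega>) \<partial>M) \<le> exp (v * s\<^sup>2 / 2))"

text \<open>
  A real \<open>m \<times> n\<close> matrix is a function \<open>A\<close> with entry \<open>A i j\<close> in row \<open>i < m\<close> and column \<open>j < n\<close>;
  a vector of length \<open>n\<close> is a function on \<open>{..<n}\<close>.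
\<close>

definition mat_vec :: "nat \<Rightarrow> (nat \<Rightarrow> nat \<Rightarrow> real) \<Rightarrow> (nat \<Rightarrow> real) \<Rightarrow> nat \<Rightarrow> real" where
  "mat_vec n A x i = (\<Sum>j<n. A i j * x j)"

text \<open>Meaningful for \<open>m > 0\<close> only: \<open>Max {}\<close> is unspecified.\<close>

definition sup_norm :: "nat \<Rightarrow> (nat \<Rightarrow> real) \<Rightarrow> real" where
  "sup_norm m y = Max ((\<lambda>i. \<bar>y i\<bar>) ` {..<m})"

definition disc :: "nat \<Rightarrow> nat \<Rightarrow> (nat \<Rightarrow> nat \<Rightarrow> real) \<Rightarrow> real" where
  "disc m n A = Min ((\<lambda>x. sup_norm m (mat_vec n A x)) ` ({..<n} \<rightarrow>\<^sub>E {-1, 1}))"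

text \<open>
  The joint law of \<open>n\<close> independent columns, each with law \<open>D\<close> (a measure on vectors). An outcome
  \<open>a\<close> lists the columns, so that \<open>a j i\<close> is the entry in row \<open>i\<close> and column \<open>j\<close>. By
  \<open>prob_space.indep_vars_iff_distr_eq_PiM\<close>, independent random vectors with law \<open>D\<close>
  on an arbitrary probability space have this joint law.
\<close>

definition iid_columns :: "nat \<Rightarrow> (nat \<Rightarrow> real) measure \<Rightarrow> (nat \<Rightarrow> nat \<Rightarrow> real) measure" where
  "iid_columns n D = (\<Pi>\<^sub>M j\<in>{..<n}. D)"

definition matrix_of_columns :: "(nat \<Rightarrow> nat \<Rightarrow> real) \<Rightarrow> nat \<Rightarrow> nat \<Rightarrow> real" where
  "matrix_of_columns a i j = a j i"

end

theory Submission
  imports Defs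
begin

text \<open>
  A coloring is built by iterating partial colorings. If all rows restricted to \<open>k\<close> remaining
  columns have squared norm at most \<open>R\<close>, round \<open>A x\<close> coordinatewise to multiples of
  \<open>2 L\<close>, where \<open>L\<close> is of order \<open>sqrt (R * ln (m / k))\<close>. The rounded vector has entropy
  at most \<open>k / 10\<close>, so two sign vectors with the same rounding differ in more than \<open>k / 4\<close>
  places, and half their difference colors these places.

  With high probability the row norms satisfy the bound \<open>R = O(\<sigma>\<^sup>2 * sqrt (n * k))\<close>
  simultaneously for all sets of \<open>k\<close> columns; this follows from a bound of order \<open>sqrt n\<close>
  on the row sums of \<open>min (y^4 / sqrt n) (y^2)\<close>, where \<open>y\<close> runs over the entries divided by
  \<open>\<sigma>\<close>. Its failure probability \<open>exp (- 3 * sqrt n)\<close> per row is what forces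
  \<open>m \<le> 2 powr sqrt n\<close>. The partial coloring costs are then dominated by a multiple of
  \<open>n powr (3/8) * k powr (1/8) * sqrt (ln (2 * m / n))\<close>, which is geometric in the rounds.
\<close>

section \<open>Partial colorings\<close>

text \<open>This is \<open>cosh x \<le> exp (x^2 / 2)\<close>, Hoeffding's lemma for a fair sign:
  probability 1/2 and range of length \<open>2 * x\<close>. Evenness in \<open>x\<close> covers
  negative arguments.\<close>

lemma exp_add_exp_minus_le:
  fixes x :: real
  shows "exp x + exp (- x) \<le> 2 * exp (x\<^sup>2 / 2)"
proof -
  have *: "exp x + exp (- x) \<le> 2 * exp (x\<^sup>2 / 2)" if "0 \<le> x" for x :: real
  proof -
    have "- (2 * x) * (1/2) + ln (1 + 1/2 * (exp (2 * x) - 1)) \<le> (2 * x)\<^sup>2 / 8"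
      by (rule Hoeffdings_lemma_aux) (use that in auto)
    hence "ln ((1 + exp (2 * x)) / 2) \<le> x + x\<^sup>2 / 2"
      by (simp add: field_simps power2_eq_square)
    hence "(1 + exp (2 * x)) / 2 \<le> exp (x + x\<^sup>2 / 2)"
      by (metis add_pos_pos exp_gt_zero exp_le_cancel_iff exp_ln half_gt_zero zero_less_one)
    hence "exp (- x) * (1 + exp (2 * x)) \<le> exp (- x) * (2 * exp (x + x\<^sup>2 / 2))"
      by (intro mult_left_mono) auto
    thus ?thesis
      by (simp add: algebra_simps flip: exp_add)
  qed
  show ?thesis
    using *[of x] *[of "- x"] by (cases "0 \<le> x") (auto simp: add.commute)
qed

text \<open>The exponential turns the linear form into a product over \<open>S\<close>, so the sum
  over the cube factors into one two-term sum per coordinate. Up to the factor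
  \<open>2 ^ card S\<close> this is the moment generating function of a Rademacher sum.\<close>

lemma sum_signs_exp_linear_le:
  fixes a :: "'j \<Rightarrow> real"
  assumes "finite S"
  shows "(\<Sum>x\<in>S \<rightarrow>\<^sub>E {-1, 1}. exp (s * (\<Sum>j\<in>S. a j * x j)))
           \<le> 2 ^ card S * exp (s\<^sup>2 * (\<Sum>j\<in>S. (a j)\<^sup>2) / 2)"
proof -
  have "(\<Sum>x\<in>S \<rightarrow>\<^sub>E {-1, 1}. exp (s * (\<Sum>j\<in>S. a j * x j)))
          = (\<Sum>x\<in>S \<rightarrow>\<^sub>E {-1, 1}. \<Prod>j\<in>S. exp (s * a j * x j))"
    using assms by (simp add: exp_sum sum_distrib_left mult.assoc)
  also have "\<dots> = (\<Prod>j\<in>S. \<Sum>y\<in>{-1, 1}. exp (s * a j * y))"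
    by (rule prod_sum_PiE[symmetric]) (use assms in auto)
  also have "\<dots> = (\<Prod>j\<in>S. exp (s * a j) + exp (- (s * a j)))"
    by (simp add: add.commute)
  also have "\<dots> \<le> (\<Prod>j\<in>S. 2 * exp ((s * a j)\<^sup>2 / 2))"
    by (intro prod_mono conjI exp_add_exp_minus_le) (auto intro: add_nonneg_nonneg)
  also have "\<dots> = 2 ^ card S * exp (s\<^sup>2 * (\<Sum>j\<in>S. (a j)\<^sup>2) / 2)"
    using assms
    by (simp add: prod.distrib power_mult_distrib sum_distrib_left sum_divide_distrib flip: exp_sum)
  finally show ?thesis .
qed

lemma abs_round_le_exp:
  fixes X L s :: real
  assumes "0 < L" "1 / 2 \<le> s * L"
  shows "\<bar>real_of_int (round (X / (2 * L)))\<bar> \<le> exp (s * (\<bar>X\<bar> - L))"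
proof (cases "round (X / (2 * L)) = 0")
  case False
  define b where "b = \<bar>real_of_int (round (X / (2 * L)))\<bar>"
  have b1: "1 \<le> b" using False by (simp add: b_def)
  have "0 < s" using assms by (smt (verit) mult_nonpos_nonneg divide_pos_pos)
  have "\<bar>real_of_int (round (X / (2 * L))) - X / (2 * L)\<bar> \<le> 1 / 2"
    by (rule of_int_round_abs_le)
  hence "b - 1 / 2 \<le> \<bar>X / (2 * L)\<bar>" unfolding b_def by linarith
  also have "\<dots> = \<bar>X\<bar> / (2 * L)" using assms by simp
  \<comment> \<open>A nonzero rounded value of modulus \<open>b\<close> needs \<open>X\<close> at
    distance at least \<open>(2 * b - 1) * L\<close> from 0. With \<open>2 * s * L \<ge> 1\<close>,
    the excess over \<open>L\<close> pays for \<open>b - 1\<close>.\<close>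
  finally have "(2 * b - 1) * L \<le> \<bar>X\<bar>" using assms by (simp add: field_simps)
  hence "2 * L * (b - 1) \<le> \<bar>X\<bar> - L" by (simp add: algebra_simps)
  hence "s * (2 * L * (b - 1)) \<le> s * (\<bar>X\<bar> - L)"
    using \<open>0 < s\<close> by (intro mult_left_mono) auto
  moreover have "1 * (b - 1) \<le> 2 * (s * L) * (b - 1)"
    using assms b1 by (intro mult_right_mono) auto
  ultimately have "1 + (b - 1) \<le> 1 + s * (\<bar>X\<bar> - L)" by (simp add: algebra_simps)
  also have "\<dots> \<le> exp (s * (\<bar>X\<bar> - L))" by (rule exp_ge_add_one_self)
  finally show ?thesis by (simp add: b_def)
qed simp

lemma sum_signs_abs_round_le:
  fixes a :: "'j \<Rightarrow> real"
  assumes "finite S" "0 < R" "(\<Sum>j\<in>S. (a j)\<^sup>2) \<le> R" "0 < L" "R \<le> 2 * L\<^sup>2"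
  shows "(\<Sum>x\<in>S \<rightarrow>\<^sub>E {-1, 1}. \<bar>real_of_int (round ((\<Sum>j\<in>S. a j * x j) / (2 * L)))\<bar>)
           \<le> 2 ^ card S * (2 * exp (- (L\<^sup>2 / (2 * R))))"
proof -
  \<comment> \<open>This \<open>s\<close> minimizes \<open>s^2 * R / 2 - s * L\<close>, with minimum
    \<open>- L^2 / (2 * R)\<close>. The hypothesis \<open>R \<le> 2 * L^2\<close> says exactly that
    \<open>s * L \<ge> 1 / 2\<close>.\<close>
  define s where "s = L / R"
  have sL: "1 / 2 \<le> s * L" using assms by (simp add: s_def field_simps power2_eq_square)
  let ?X = "\<lambda>x. \<Sum>j\<in>S. a j * x j"
  have s0: "0 < s" using assms by (simp add: s_def)
  have pt: "\<bar>real_of_int (round (?X x / (2 * L)))\<bar>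
          \<le> exp (- (s * L)) * (exp (s * ?X x) + exp ((- s) * ?X x))" for x
  proof -
    have "\<bar>real_of_int (round (?X x / (2 * L)))\<bar> \<le> exp (s * (\<bar>?X x\<bar> - L))"
      by (rule abs_round_le_exp) (use assms sL in auto)
    also have "\<dots> = exp (- (s * L)) * exp (s * \<bar>?X x\<bar>)"
      by (simp add: algebra_simps flip: exp_add)
    also have "\<dots> \<le> exp (- (s * L)) * (exp (s * ?X x) + exp ((- s) * ?X x))"
      by (intro mult_left_mono) (auto simp: abs_if)
    finally show ?thesis .
  qed
  have bd: "(\<Sum>x\<in>S \<rightarrow>\<^sub>E {-1, 1}. exp (t * ?X x)) \<le> 2 ^ card S * exp (s\<^sup>2 * R / 2)"
    if "t\<^sup>2 = s\<^sup>2" for t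
  proof -
    have "(\<Sum>x\<in>S \<rightarrow>\<^sub>E {-1, 1}. exp (t * ?X x))
        \<le> 2 ^ card S * exp (t\<^sup>2 * (\<Sum>j\<in>S. (a j)\<^sup>2) / 2)"
      by (rule sum_signs_exp_linear_le) fact
    also have "\<dots> \<le> 2 ^ card S * exp (s\<^sup>2 * R / 2)"
      unfolding that using assms by (intro mult_left_mono) (auto intro!: mult_left_mono divide_right_mono)
    finally show ?thesis .
  qed
  have "(\<Sum>x\<in>S \<rightarrow>\<^sub>E {-1, 1}. \<bar>real_of_int (round (?X x / (2 * L)))\<bar>)
      \<le> (\<Sum>x\<in>S \<rightarrow>\<^sub>E {-1, 1}. exp (- (s * L)) * (exp (s * ?X x) + exp ((- s) * ?X x)))"
    by (intro sum_mono pt)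
  also have "\<dots> = exp (- (s * L)) * ((\<Sum>x\<in>S \<rightarrow>\<^sub>E {-1, 1}. exp (s * ?X x)) +
                                   (\<Sum>x\<in>S \<rightarrow>\<^sub>E {-1, 1}. exp ((- s) * ?X x)))"
    by (simp only: distrib_left sum.distrib flip: sum_distrib_left)
  also have "\<dots> \<le> exp (- (s * L)) * (2 ^ card S * exp (s\<^sup>2 * R / 2) + 2 ^ card S * exp (s\<^sup>2 * R / 2))"
    by (intro mult_left_mono add_mono bd) auto
  also have "\<dots> = 2 ^ card S * (2 * (exp (- (s * L)) * exp (s\<^sup>2 * R / 2)))"
    by (simp only: mult_ac mult_2 distrib_left)
  also have "exp (- (s * L)) * exp (s\<^sup>2 * R / 2) = exp (s\<^sup>2 * R / 2 - s * L)"
    by (simp flip: exp_add)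
  also have "s\<^sup>2 * R / 2 - s * L = - (L\<^sup>2 / (2 * R))"
    using assms by (simp add: s_def field_simps power2_eq_square)
  finally show ?thesis .
qed

section \<open>Code lengths from a geometric law on the integers\<close>

text \<open>The two-sided geometric distribution with ratio \<open>q\<close>. For small
  \<open>q\<close> the value 0 costs almost nothing to encode, and the cost grows linearly in the
  modulus.\<close>

definition geom_weight :: "real \<Rightarrow> int \<Rightarrow> real" where
  "geom_weight q s = (1 - q) / (1 + q) * q ^ nat \<bar>s\<bar>"

lemma geom_weight_pos: "0 < q \<Longrightarrow> q < 1 \<Longrightarrow> 0 < geom_weight q s"
  by (simp add: geom_weight_def)

text \<open>Induction on \<open>W\<close> gives the closed form \<open>1 + q - 2 * q ^ Suc W\<close>
  for \<open>1 - q\<close> times the unnormalized sum. A finite window is enough because only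
  finitely many rounded values occur.\<close>

lemma sum_geom_weight_le_1:
  assumes "0 < q" "q < 1"
  shows "(\<Sum>s\<in>{- int W..int W}. geom_weight q s) \<le> 1"
proof -
  have "(1 - q) * (\<Sum>s\<in>{- int W..int W}. q ^ nat \<bar>s\<bar>) = 1 + q - 2 * q ^ Suc W"
  proof (induction W)
    case (Suc W)
    have "{- int (Suc W)..int (Suc W)}
            = insert (int (Suc W)) (insert (- int (Suc W)) {- int W..int W})"
      by auto
    hence "(\<Sum>s\<in>{- int (Suc W)..int (Suc W)}. q ^ nat \<bar>s\<bar>)
            = 2 * q ^ Suc W + (\<Sum>s\<in>{- int W..int W}. q ^ nat \<bar>s\<bar>)"
      by (simp add: nat_add_distrib)
    hence "(1 - q) * (\<Sum>s\<in>{- int (Suc W)..int (Suc W)}. q ^ nat \<bar>s\<bar>)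
            = (1 - q) * (2 * q ^ Suc W) + (1 - q) * (\<Sum>s\<in>{- int W..int W}. q ^ nat \<bar>s\<bar>)"
      by (simp only: distrib_left)
    also have "\<dots> = 1 + q - 2 * q ^ Suc (Suc W)"
      unfolding Suc.IH by (simp add: algebra_simps)
    finally show ?case .
  qed (simp add: algebra_simps)
  hence "(1 - q) * (\<Sum>s\<in>{- int W..int W}. q ^ nat \<bar>s\<bar>) \<le> 1 + q"
    using assms by simp
  hence "(1 - q) * (\<Sum>s\<in>{- int W..int W}. q ^ nat \<bar>s\<bar>) / (1 + q) \<le> 1"
    using assms by (simp only: divide_le_eq_1) simp
  thus ?thesis
    unfolding geom_weight_def by (simp only: flip: sum_distrib_left) simp
qed

lemma neg_ln_geom_weight_le:
  assumes "0 < q" "q \<le> 1 / 3"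
  shows "- ln (geom_weight q s) \<le> 3 * q + \<bar>real_of_int s\<bar> * ln (1 / q)"
proof -
  have "- ln (geom_weight q s) = ln ((1 + q) / (1 - q)) + \<bar>real_of_int s\<bar> * ln (1 / q)"
  proof -
    have "ln (geom_weight q s) = ln ((1 - q) / (1 + q)) + ln (q ^ nat \<bar>s\<bar>)"
      unfolding geom_weight_def using assms by (intro ln_mult_pos) auto
    thus ?thesis
      using assms by (simp add: ln_div ln_realpow)
  qed
  also have "ln ((1 + q) / (1 - q)) \<le> (1 + q) / (1 - q) - 1"
    using assms by (intro ln_le_minus_one) simp
  also have "(1 + q) / (1 - q) - 1 \<le> 3 * q"
    using assms by (simp add: field_simps)
  finally show ?thesis by simp
qed

section \<open>Entropy against the size of Hamming balls\<close>

text \<open>Give \<open>y\<close> the weight \<open>(1 / 4) ^ d\<close>, where \<open>d\<close> is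
  its Hamming distance to \<open>x\<close>. The whole cube has weight
  \<open>(5 / 4) ^ card S\<close>, while each \<open>y\<close> within distance
  \<open>card S / 4\<close> has weight at least \<open>(1 / 4)\<close> to the power
  \<open>card S / 4\<close>, which is \<open>sqrt (1 / 2) ^ card S\<close>.\<close>

lemma card_near_sign_vectors_le:
  assumes "finite S" "x \<in> S \<rightarrow>\<^sub>E {-1, 1::real}"
    and "N \<subseteq> (S \<rightarrow>\<^sub>E {-1, 1})"
    and near: "\<And>y. y \<in> N \<Longrightarrow> 4 * card {j\<in>S. x j \<noteq> y j} \<le> card S"
  shows "real (card N) \<le> (5 / 4 * sqrt 2) ^ card S"
proof -
  let ?k = "card S"
  let ?d = "\<lambda>y. card {j\<in>S. x j \<noteq> y j}"
  have fin: "finite (S \<rightarrow>\<^sub>E {-1, 1::real})" using assms by (intro finite_PiE) auto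
  have quarter: "(1 / 4 :: real) = sqrt (1 / 2) ^ 4"
    by (simp add: power4_eq_xxxx flip: real_sqrt_mult)
  have lower: "sqrt (1 / 2) ^ ?k \<le> (1 / 4 :: real) ^ ?d y" if "y \<in> N" for y
  proof -
    have "sqrt (1 / 2) ^ ?k \<le> sqrt (1 / 2 :: real) ^ (4 * ?d y)"
      using near[OF that] by (intro power_decreasing) auto
    also have "\<dots> = (1 / 4) ^ ?d y" unfolding quarter by (simp add: power_mult)
    finally show ?thesis .
  qed
  have "real (card N) * sqrt (1 / 2) ^ ?k = (\<Sum>y\<in>N. sqrt (1 / 2) ^ ?k)" by simp
  also have "\<dots> \<le> (\<Sum>y\<in>N. (1 / 4) ^ ?d y)" by (intro sum_mono lower)
  also have "\<dots> \<le> (\<Sum>y\<in>S \<rightarrow>\<^sub>E {-1, 1}. (1 / 4) ^ ?d y)"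
    using assms fin by (intro sum_mono2) auto
  also have "\<dots> = (\<Sum>y\<in>S \<rightarrow>\<^sub>E {-1, 1}. \<Prod>j\<in>S. if x j \<noteq> y j then 1 / 4 else 1)"
    using assms by (intro sum.cong refl) (simp add: flip: prod.inter_filter)
  also have "\<dots> = (\<Prod>j\<in>S. \<Sum>t\<in>{-1, 1}. if x j \<noteq> t then 1 / 4 else 1)"
    by (rule prod_sum_PiE[symmetric]) (use assms in auto)
  also have "\<dots> = (\<Prod>j\<in>S. 5 / 4)"
    using assms(2) by (intro prod.cong refl) (force dest: PiE_mem)
  finally have "real (card N) * sqrt (1 / 2) ^ ?k \<le> (5 / 4) ^ ?k" by simp
  hence "real (card N) * sqrt (1 / 2) ^ ?k * sqrt 2 ^ ?k \<le> (5 / 4) ^ ?k * sqrt 2 ^ ?k"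
    by (intro mult_right_mono) auto
  moreover have "sqrt (1 / 2) ^ ?k * sqrt 2 ^ ?k = (1::real)"
    by (simp flip: power_mult_distrib real_sqrt_mult)
  ultimately show ?thesis by (simp only: mult.assoc power_mult_distrib)
qed

text \<open>The numerical margin of the entropy argument: the growth rate of a Hamming ball of
  relative radius 1/4, times the entropy allowance 1/10 per coordinate, stays below that of the
  cube.\<close>

lemma five_quarters_sqrt2_exp_less: "5 / 4 * sqrt 2 * exp (1 / 10) < (2::real)"
proof -
  have "exp (1 / 10) \<le> 1 + 1 / 10 + (1 / 10 :: real)\<^sup>2" by (rule exp_bound) auto
  hence e: "exp (1 / 10) \<le> (111 / 100 :: real)" by (simp add: power2_eq_square)
  have s: "sqrt 2 \<le> 71 / 50" by (rule real_le_lsqrt) (auto simp: power2_eq_square)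
  have "5 / 4 * sqrt 2 * exp (1 / 10) \<le> 5 / 4 * (71 / 50) * (111 / 100)"
    using e s by (intro mult_mono) auto
  thus ?thesis by simp
qed

text \<open>
  Kraft's inequality for the weight \<open>w\<close>: small fibres force the average code length
  \<open>- ln w\<close> to be large.
\<close>

lemma fibre_entropy_bound:
  fixes w :: "'v \<Rightarrow> real"
  assumes "finite X" "X \<noteq> {}" "0 < M"
    and fibre: "\<And>x. x \<in> X \<Longrightarrow> real (card {y\<in>X. f y = f x}) \<le> M"
    and w: "\<And>v. v \<in> f ` X \<Longrightarrow> 0 < w v" "(\<Sum>v\<in>f ` X. w v) \<le> 1"
  shows "real (card X) * ln (real (card X) / M) \<le> (\<Sum>x\<in>X. - ln (w (f x)))"
proof -
  let ?N = "real (card X)"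
  have N: "0 < ?N" using assms by (simp add: card_gt_0_iff)
  have "(\<Sum>x\<in>X. w (f x)) = (\<Sum>v\<in>f ` X. \<Sum>x\<in>{x\<in>X. f x = v}. w (f x))"
    by (rule sum.image_gen) fact
  also have "\<dots> = (\<Sum>v\<in>f ` X. real (card {x\<in>X. f x = v}) * w v)"
    by (intro sum.cong refl) simp
  also have "\<dots> \<le> (\<Sum>v\<in>f ` X. M * w v)"
    using fibre w by (intro sum_mono mult_right_mono) (auto simp: less_imp_le)
  also have "\<dots> \<le> M" using w(2) \<open>0 < M\<close> by (simp flip: sum_distrib_left)
  finally have total: "(\<Sum>x\<in>X. w (f x)) \<le> M" .
  \<comment> \<open>Gibbs' inequality by way of \<open>ln u \<le> u - 1\<close>; the factor
    \<open>?N / M\<close> makes the right side at most 0.\<close>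
  have "(\<Sum>x\<in>X. ln (w (f x)) + ln (?N / M)) \<le> (\<Sum>x\<in>X. w (f x) * (?N / M) - 1)"
  proof (intro sum_mono)
    fix x assume "x \<in> X"
    hence "0 < w (f x)" using w by auto
    hence "ln (w (f x)) + ln (?N / M) = ln (w (f x) * (?N / M))"
      using N \<open>0 < M\<close> by (intro ln_mult_pos[symmetric]) auto
    also have "\<dots> \<le> w (f x) * (?N / M) - 1"
      using \<open>0 < w (f x)\<close> N \<open>0 < M\<close> by (intro ln_le_minus_one) auto
    finally show "ln (w (f x)) + ln (?N / M) \<le> w (f x) * (?N / M) - 1" .
  qed
  also have "\<dots> = (\<Sum>x\<in>X. w (f x)) * (?N / M) - ?N"
    by (simp only: sum_subtractf sum_distrib_right sum_constant mult_1_right)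
  also have "\<dots> \<le> M * (?N / M) - ?N"
    using total N \<open>0 < M\<close> by (intro diff_right_mono mult_right_mono) auto
  also have "\<dots> = 0" using \<open>0 < M\<close> by simp
  finally show ?thesis by (simp add: sum.distrib sum_negf)
qed

text \<open>Otherwise every fibre of the rounding lies in a Hamming ball of radius
  \<open>card S / 4\<close>, which forces a large average code length. The geometric code
  nevertheless needs only \<open>card S / 10\<close> on average.\<close>

lemma exists_far_pair_same_rounding:
  fixes a :: "nat \<Rightarrow> 'j \<Rightarrow> real"
  assumes fin: "finite S" and k: "0 < card S" "card S \<le> m" and R: "0 < R"
    and rows: "\<And>i. i < m \<Longrightarrow> (\<Sum>j\<in>S. (a i j)\<^sup>2) \<le> R"
    and L: "L = 2 * sqrt (R * ln (50 * real m / real (card S)))"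
  shows "\<exists>x\<in>S \<rightarrow>\<^sub>E {-1, 1}. \<exists>y\<in>S \<rightarrow>\<^sub>E {-1, 1}. card S < 4 * card {j\<in>S. x j \<noteq> y j} \<and>
           (\<forall>i<m. round ((\<Sum>j\<in>S. a i j * x j) / (2 * L)) = round ((\<Sum>j\<in>S. a i j * y j) / (2 * L)))"
proof (rule ccontr)
  assume none: "\<not> ?thesis"
  let ?k = "card S" and ?X = "S \<rightarrow>\<^sub>E {-1, 1::real}"
  \<comment> \<open>Each row will cost at most \<open>5 * q\<close> on average, so \<open>m\<close>
    rows cost \<open>?k / 10\<close>.\<close>
  define q where "q = real ?k / (50 * real m)"
  have q: "0 < q" "q \<le> 1 / 50" using k by (auto simp: q_def field_simps)
  have lnq: "ln (50 * real m / real ?k) = ln (1 / q)" by (simp add: q_def)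
  have "1 \<le> ln (1 / q)"
  proof -
    have "exp 1 \<le> (1 / q :: real)"
    proof -
      have "exp 1 \<le> (3::real)" using exp_le by simp
      also have "\<dots> \<le> 1 / q" using q by (simp add: field_simps)
      finally show ?thesis .
    qed
    thus ?thesis using q by (subst ln_ge_iff) auto
  qed
  have L0: "0 < L" unfolding L lnq using R \<open>1 \<le> ln (1 / q)\<close> by simp
  have L2: "L\<^sup>2 = 4 * (R * ln (1 / q))"
    unfolding L lnq using R \<open>1 \<le> ln (1 / q)\<close> by (simp add: power_mult_distrib)
  define b where "b = (\<lambda>i x. round ((\<Sum>j\<in>S. a i j * x j) / (2 * L)))"
  define f where "f = (\<lambda>x. \<lambda>i\<in>{..<m}. b i x)"
  define w where "w = (\<lambda>v. \<Prod>i<m. geom_weight q (v i))"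
  define M :: real where "M = (5 / 4 * sqrt 2) ^ ?k"
  have finX: "finite ?X" using fin by (intro finite_PiE) auto
  have cardX: "real (card ?X) = 2 ^ ?k"
    using fin by (simp add: card_PiE numeral_2_eq_2)
  have X0: "?X \<noteq> {}" by (auto simp: PiE_eq_empty_iff)
  have M0: "0 < M" by (simp add: M_def)
  \<comment> \<open>A common bound places all rounded vectors in a finite box, on which the product
    weight factors and has total at most 1.\<close>
  obtain W where W: "\<And>i x. i < m \<Longrightarrow> x \<in> ?X \<Longrightarrow> \<bar>b i x\<bar> \<le> int W"
  proof -
    let ?A = "(\<lambda>(i, x). \<bar>b i x\<bar>) ` ({..<m} \<times> ?X)"
    have "finite ?A" using finX by auto
    then obtain B where B: "\<And>t. t \<in> ?A \<Longrightarrow> t \<le> B"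
      using bdd_above_finite unfolding bdd_above_def by meson
    have "\<bar>b i x\<bar> \<le> int (nat B)" if "i < m" "x \<in> ?X" for i x
    proof -
      have "\<bar>b i x\<bar> \<in> ?A" using that by (intro rev_image_eqI[of "(i, x)"]) auto
      from B[OF this] show ?thesis by linarith
    qed
    thus thesis by (rule that[of "nat B"])
  qed
  have "real (card ?X) * ln (real (card ?X) / M) \<le> (\<Sum>x\<in>?X. - ln (w (f x)))"
  proof (rule fibre_entropy_bound[where f = f and w = w, OF finX X0 M0])
    fix x assume x: "x \<in> ?X"
    show "real (card {y\<in>?X. f y = f x}) \<le> M"
      unfolding M_def
    proof (rule card_near_sign_vectors_le[OF fin x])
      fix y assume y: "y \<in> {y\<in>?X. f y = f x}"
      hence "f x i = f y i" for i by simp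
      hence "b i x = b i y" if "i < m" for i
        using that unfolding f_def by (metis lessThan_iff restrict_apply')
      hence "\<not> ?k < 4 * card {j\<in>S. x j \<noteq> y j}"
        using none x y unfolding b_def by blast
      thus "4 * card {j\<in>S. x j \<noteq> y j} \<le> ?k" by simp
    qed auto
  next
    show "0 < w v" for v unfolding w_def using q by (intro prod_pos geom_weight_pos) auto
  next
    have "(\<Sum>v\<in>f ` ?X. w v) \<le> (\<Sum>v\<in>{..<m} \<rightarrow>\<^sub>E {- int W..int W}. w v)"
    proof (rule sum_mono2)
      have "f x \<in> {..<m} \<rightarrow>\<^sub>E {- int W..int W}" if "x \<in> ?X" for x
        unfolding f_def using W[OF _ that] by (intro restrict_PiE_iff[THEN iffD2] ballI) (force simp: abs_le_iff)
      thus "f ` ?X \<subseteq> {..<m} \<rightarrow>\<^sub>E {- int W..int W}" by blast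
      show "0 \<le> w v" for v unfolding w_def using q
        by (intro prod_nonneg) (auto intro!: less_imp_le geom_weight_pos)
    qed (auto intro: finite_PiE)
    also have "\<dots> = (\<Prod>i<m. \<Sum>s\<in>{- int W..int W}. geom_weight q s)"
      unfolding w_def by (rule prod_sum_PiE[symmetric]) auto
    also have "\<dots> \<le> 1"
      using q sum_geom_weight_le_1[of q W]
      by (intro prod_le_1 conjI sum_nonneg less_imp_le[OF geom_weight_pos]) auto
    finally show "(\<Sum>v\<in>f ` ?X. w v) \<le> 1" .
  qed
  also have "\<dots> = (\<Sum>x\<in>?X. \<Sum>i<m. - ln (geom_weight q (b i x)))"
  proof (intro sum.cong refl)
    fix x
    have "geom_weight q s \<noteq> 0" for s
      using q geom_weight_pos[of q s] by simp
    hence "ln (w (f x)) = (\<Sum>i<m. ln (geom_weight q (f x i)))"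
      unfolding w_def by (intro ln_prod) auto
    thus "- ln (w (f x)) = (\<Sum>i<m. - ln (geom_weight q (b i x)))"
      by (simp add: f_def sum_negf)
  qed
  also have "\<dots> \<le> (\<Sum>x\<in>?X. \<Sum>i<m. 3 * q + \<bar>real_of_int (b i x)\<bar> * ln (1 / q))"
    using q by (intro sum_mono neg_ln_geom_weight_le) auto
  also have "\<dots> = (\<Sum>i<m. \<Sum>x\<in>?X. 3 * q + \<bar>real_of_int (b i x)\<bar> * ln (1 / q))"
    by (rule sum.swap)
  also have "\<dots> = (\<Sum>i<m. 2 ^ ?k * (3 * q) + (\<Sum>x\<in>?X. \<bar>real_of_int (b i x)\<bar>) * ln (1 / q))"
    by (intro sum.cong refl) (simp add: sum.distrib cardX sum_distrib_right)
  also have "\<dots> \<le> (\<Sum>i<m. 2 ^ ?k * (3 * q) + 2 ^ ?k * (2 * q))"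
  proof (intro sum_mono add_left_mono)
    fix i assume "i \<in> {..<m}"
    hence "(\<Sum>x\<in>?X. \<bar>real_of_int (b i x)\<bar>) \<le> 2 ^ ?k * (2 * exp (- (L\<^sup>2 / (2 * R))))"
      unfolding b_def using fin R rows L0 L2 \<open>1 \<le> ln (1 / q)\<close>
      by (intro sum_signs_abs_round_le) (auto simp: mult_le_cancel_left1)
    \<comment> \<open>The factor 2 in \<open>L\<close> is chosen to make the tail
      \<open>q^2\<close>: one factor \<open>q\<close> remains after the other absorbs the code
      length through \<open>ln (1 / q) \<le> 1 / q\<close>.\<close>
    also have "L\<^sup>2 / (2 * R) = 2 * ln (1 / q)" using R by (simp add: L2)
    also have "exp (- (2 * ln (1 / q))) = q\<^sup>2"
      using q by (simp add: ln_div exp_double)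
    finally have "(\<Sum>x\<in>?X. \<bar>real_of_int (b i x)\<bar>) * ln (1 / q) \<le> 2 ^ ?k * (2 * q\<^sup>2) * ln (1 / q)"
      using \<open>1 \<le> ln (1 / q)\<close> by (intro mult_right_mono) auto
    also have "\<dots> \<le> 2 ^ ?k * (2 * q\<^sup>2) * (1 / q)"
      using ln_le_minus_one[of "1 / q"] q by (intro mult_left_mono) auto
    also have "\<dots> = 2 ^ ?k * (2 * q)" using q by (simp add: power2_eq_square)
    finally show "(\<Sum>x\<in>?X. \<bar>real_of_int (b i x)\<bar>) * ln (1 / q) \<le> 2 ^ ?k * (2 * q)" .
  qed
  also have "\<dots> = 2 ^ ?k * (real ?k / 10)"
    using k by (simp add: q_def field_simps)
  finally have "2 ^ ?k * ln (2 ^ ?k / M) \<le> 2 ^ ?k * (real ?k / 10)" unfolding cardX .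
  hence "ln (2 ^ ?k / M) \<le> real ?k / 10" by simp
  hence "2 ^ ?k / M \<le> exp (real ?k / 10)"
    using M0 by (metis divide_pos_pos exp_le_cancel_iff exp_ln zero_less_numeral zero_less_power)
  also have "exp (real ?k / 10) = exp (1 / 10) ^ ?k" by (simp flip: exp_of_nat_mult)
  finally have "2 ^ ?k \<le> (5 / 4 * sqrt 2 * exp (1 / 10)) ^ ?k"
    using M0 by (simp add: M_def field_simps power_mult_distrib)
  moreover have "(5 / 4 * sqrt 2 * exp (1 / 10)) ^ ?k < (2::real) ^ ?k"
    using k by (intro power_strict_mono five_quarters_sqrt2_exp_less) auto
  ultimately show False by simp
qed

lemma partial_coloring:
  fixes a :: "nat \<Rightarrow> 'j \<Rightarrow> real"
  assumes fin: "finite S" and k: "0 < card S" "card S \<le> m" and R: "0 < R"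
    and rows: "\<And>i. i < m \<Longrightarrow> (\<Sum>j\<in>S. (a i j)\<^sup>2) \<le> R"
  shows "\<exists>z. z ` S \<subseteq> {-1, 0, 1} \<and> 4 * card {j\<in>S. z j = 0} \<le> 3 * card S \<and>
           (\<forall>i<m. \<bar>\<Sum>j\<in>S. a i j * z j\<bar> \<le> 2 * sqrt (R * ln (50 * real m / real (card S))))"
proof -
  define L where "L = 2 * sqrt (R * ln (50 * real m / real (card S)))"
  have "1 < 50 * real m / real (card S)" using k by (simp add: field_simps)
  hence L0: "0 < L" using R by (simp add: L_def)
  obtain x y where xy: "x \<in> S \<rightarrow>\<^sub>E {-1, 1}" "y \<in> S \<rightarrow>\<^sub>E {-1, 1}"
      "card S < 4 * card {j\<in>S. x j \<noteq> y j}"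
    and same: "\<And>i. i < m \<Longrightarrow>
      round ((\<Sum>j\<in>S. a i j * x j) / (2 * L)) = round ((\<Sum>j\<in>S. a i j * y j) / (2 * L))"
    using exists_far_pair_same_rounding[of S m R a, OF fin k R rows L_def] by blast
  \<comment> \<open>The zeros of \<open>z\<close> are the places where \<open>x\<close> and
    \<open>y\<close> agree, fewer than three quarters of \<open>S\<close>. Equal rounding puts the
    two sums in a common cell of width \<open>2 * L\<close>, and halving leaves
    \<open>L\<close>.\<close>
  define z where "z = (\<lambda>j. (x j - y j) / 2)"
  have sgn: "x j \<in> {-1, 1}" "y j \<in> {-1, 1}" if "j \<in> S" for j
    using xy that by (auto dest: PiE_mem)
  have "z ` S \<subseteq> {-1, 0, 1}" using sgn by (fastforce simp: z_def)
  moreover have "4 * card {j\<in>S. z j = 0} \<le> 3 * card S"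
  proof -
    have "card S = card {j\<in>S. z j = 0} + card {j\<in>S. x j \<noteq> y j}"
      using fin by (subst card_Un_disjoint[symmetric]) (auto simp: z_def intro!: arg_cong[where f = card])
    thus ?thesis using xy(3) by linarith
  qed
  moreover have "\<bar>\<Sum>j\<in>S. a i j * z j\<bar> \<le> L" if "i < m" for i
  proof -
    define u where "u = (\<Sum>j\<in>S. a i j * x j)"
    define v where "v = (\<Sum>j\<in>S. a i j * y j)"
    have "\<bar>u / (2 * L) - v / (2 * L)\<bar> \<le> 1"
      using of_int_round_abs_le[of "u / (2 * L)"] of_int_round_abs_le[of "v / (2 * L)"] same[OF that]
      unfolding u_def v_def by linarith
    hence "\<bar>u - v\<bar> \<le> 2 * L" using L0 by (simp add: field_simps flip: diff_divide_distrib)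
    moreover have "(\<Sum>j\<in>S. a i j * z j) = (u - v) / 2"
      by (simp add: u_def v_def z_def sum_divide_distrib right_diff_distrib diff_divide_distrib
               flip: sum_subtractf)
    ultimately show ?thesis by simp
  qed
  ultimately show ?thesis unfolding L_def by blast
qed

section \<open>From partial colorings to full colorings\<close>

text \<open>\<open>F k\<close> is the discrepancy budget for \<open>k\<close> uncolored columns. It
  has to cover one partial coloring and the budget of whatever number \<open>l\<close> of columns
  survives, of which only \<open>4 * l \<le> 3 * k\<close> is known.\<close>

lemma coloring_by_iteration:
  fixes a :: "nat \<Rightarrow> 'j \<Rightarrow> real"
  assumes fin: "finite S" and km: "card S \<le> m"
    and R: "\<And>k. 0 < k \<Longrightarrow> 0 < R k"
    and rows: "\<And>i T. i < m \<Longrightarrow> T \<subseteq> S \<Longrightarrow> (\<Sum>j\<in>T. (a i j)\<^sup>2) \<le> R (card T)"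
    and F0: "0 \<le> F 0"
    and F: "\<And>k l. 0 < k \<Longrightarrow> k \<le> card S \<Longrightarrow> 4 * l \<le> 3 * k \<Longrightarrow>
              2 * sqrt (R k * ln (50 * real m / real k)) + F l \<le> F k"
  shows "\<exists>x\<in>S \<rightarrow>\<^sub>E {-1, 1}. \<forall>i<m. \<bar>\<Sum>j\<in>S. a i j * x j\<bar> \<le> F (card S)"
  using assms
proof (induction "card S" arbitrary: S rule: less_induct)
  case less
  note fin = less.prems(1)
  show ?case
  proof (cases "S = {}")
    case True
    thus ?thesis using less.prems by simp
  next
    case False
    hence k: "0 < card S" using fin by (simp add: card_gt_0_iff)
    obtain z where z: "z ` S \<subseteq> {-1, 0, 1}" "4 * card {j\<in>S. z j = 0} \<le> 3 * card S"
      "\<And>i. i < m \<Longrightarrow> \<bar>\<Sum>j\<in>S. a i j * z j\<bar> \<le> 2 * sqrt (R (card S) * ln (50 * real m / real (card S)))"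
      using partial_coloring[of S m "R (card S)" a, OF fin k less.prems(2) less.prems(3)[OF k]
          less.prems(4)[OF _ subset_refl]]
      by blast
    define T where "T = {j\<in>S. z j = 0}"
    have T: "T \<subseteq> S" "finite T" using fin by (auto simp: T_def)
    have cT: "card T < card S" using z(2) k unfolding T_def by linarith
    have "\<exists>x\<in>T \<rightarrow>\<^sub>E {-1, 1}. \<forall>i<m. \<bar>\<Sum>j\<in>T. a i j * x j\<bar> \<le> F (card T)"
      using less.prems T cT by (intro less.hyps) (auto intro: order_trans)
    then obtain x where x: "x \<in> T \<rightarrow>\<^sub>E {-1, 1}"
      "\<And>i. i < m \<Longrightarrow> \<bar>\<Sum>j\<in>T. a i j * x j\<bar> \<le> F (card T)" by blast
    define u where "u = (\<lambda>j\<in>S. if j \<in> T then x j else z j)"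
    have "u \<in> S \<rightarrow>\<^sub>E {-1, 1}"
    proof (rule PiE_I)
      fix j assume "j \<in> S"
      thus "u j \<in> {-1, 1}" using z(1) x(1) by (auto simp: u_def T_def dest: PiE_mem)
    qed (simp add: u_def)
    moreover have "\<bar>\<Sum>j\<in>S. a i j * u j\<bar> \<le> F (card S)" if "i < m" for i
    proof -
      \<comment> \<open>Since \<open>z\<close> vanishes on \<open>T\<close>, the recursive coloring
        adds to it without overlap.\<close>
      have "(\<Sum>j\<in>S. a i j * u j) = (\<Sum>j\<in>S. a i j * z j + (if j \<in> T then a i j * x j else 0))"
        by (intro sum.cong refl) (auto simp: u_def T_def)
      also have "\<dots> = (\<Sum>j\<in>S. a i j * z j) + (\<Sum>j\<in>T. a i j * x j)"
        using fin T by (simp add: sum.distrib sum.inter_restrict[symmetric] Int_absorb1)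
      finally have "\<bar>\<Sum>j\<in>S. a i j * u j\<bar>
          \<le> 2 * sqrt (R (card S) * ln (50 * real m / real (card S))) + F (card T)"
        using z(3)[OF that] x(2)[OF that] by linarith
      also have "\<dots> \<le> F (card S)"
        using less.prems(6)[OF k] z(2) by (simp add: T_def)
      finally show ?thesis .
    qed
    ultimately show ?thesis by blast
  qed
qed

text \<open>The logarithm splits into \<open>ln 25\<close>, \<open>ln (2 * m / n)\<close> and
  \<open>ln (n / k)\<close>. The constant is absorbed because
  \<open>ln (2 * m / n) \<ge> ln 2\<close>. The last term is traded for a power of
  \<open>n / k\<close> small enough that the cost of a round still decreases with
  \<open>k\<close>.\<close>

lemma ln_quotient_le_powr:
  fixes k n m :: nat
  assumes "1 \<le> k" "k \<le> n" "n \<le> m"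
  shows "ln (50 * real m / real k)
           \<le> 12 * ln (2 * real m / real n) * (real n / real k) powr (1 / 4)"
proof -
  define l where "l = ln (2 * real m / real n)"
  define z where "z = (real n / real k) powr (1 / 4)"
  have z1: "1 \<le> z" unfolding z_def using assms by (intro ge_one_powr_ge_zero) auto
  have "ln 2 \<le> l" unfolding l_def using assms by (subst ln_le_cancel_iff) (auto simp: field_simps)
  hence l: "2 / 3 \<le> l" "0 \<le> l" "5 * ln 2 \<le> 5 * l" using ln2_ge_two_thirds by auto
  have "50 * real m / real k = 25 * ((2 * real m / real n) * (real n / real k))"
    using assms by simp
  hence "ln (50 * real m / real k) = ln (25 * ((2 * real m / real n) * (real n / real k)))"
    by (rule arg_cong)
  also have "\<dots> = ln 25 + (l + ln (real n / real k))"
    unfolding l_def using assms by (subst ln_mult_pos, simp, simp)+ simp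
  finally have "ln (50 * real m / real k) = ln 25 + (l + ln (real n / real k))" .
  moreover have "ln (25::real) \<le> 5 * l"
  proof -
    have "ln (25::real) \<le> ln (2 ^ 5)" by (subst ln_le_cancel_iff) auto
    also have "\<dots> = 5 * ln 2" by (subst ln_realpow) auto
    finally show ?thesis using l by simp
  qed
  \<comment> \<open>Here \<open>n / k\<close> is \<open>z ^ 4\<close>, and
    \<open>ln z \<le> z - 1\<close>.\<close>
  moreover have "ln (real n / real k) \<le> 4 * z"
  proof -
    have "ln z = ln (real n / real k) / 4" unfolding z_def using assms by (simp add: ln_powr)
    moreover have "ln z \<le> z - 1" using z1 by (intro ln_le_minus_one) auto
    ultimately show ?thesis by simp
  qed
  moreover have "6 * l \<le> 6 * l * z" using mult_left_mono[OF z1, of "6 * l"] l by simp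
  moreover have "4 * z \<le> 6 * l * z" using mult_right_mono[of 4 "6 * l" z] l z1 by simp
  ultimately have "ln (50 * real m / real k) \<le> 12 * l * z" by simp
  thus ?thesis by (simp add: l_def z_def)
qed

text \<open>Keeping at most three quarters of the columns shrinks \<open>k powr (1 / 8)\<close> by
  at least the factor 31/32, so the costs of the rounds form a geometric series.\<close>

lemma three_quarters_powr_le: "(3 / 4) powr (1 / 8) \<le> (31 / 32 :: real)"
proof -
  have "(3 / 4) powr (1 / 8) \<le> ((31 / 32) ^ 8) powr (1 / 8 :: real)"
    by (intro powr_mono2) (auto simp: power_divide)
  also have "\<dots> = ((31 / 32) powr 8) powr (1 / 8 :: real)" by simp
  also have "\<dots> = 31 / 32" by (subst powr_powr) simp
  finally show ?thesis .
qed

lemma coloring_of_regular_rows: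
  fixes a :: "nat \<Rightarrow> nat \<Rightarrow> real"
  assumes nm: "1 \<le> n" "n \<le> m" and V: "0 < V"
    and rows: "\<And>i T. i < m \<Longrightarrow> T \<subseteq> {..<n} \<Longrightarrow>
                 (\<Sum>j\<in>T. (a i j)\<^sup>2) \<le> V * sqrt (real n * real (card T))"
  shows "\<exists>x\<in>{..<n} \<rightarrow>\<^sub>E {-1, 1}. \<forall>i<m.
           \<bar>\<Sum>j<n. a i j * x j\<bar> \<le> 64 * sqrt (12 * V * (real n * ln (2 * real m / real n)))"
proof -
  define l where "l = ln (2 * real m / real n)"
  have "1 \<le> 2 * real m / real n" using nm by (simp add: field_simps)
  hence l0: "0 \<le> l" by (simp add: l_def)
  define c where "c = sqrt (12 * V * l) * real n powr (3 / 8)"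
  have c0: "0 \<le> c" using V l0 by (simp add: c_def)
  \<comment> \<open>A round costs at most \<open>2 * c * k powr (1 / 8)\<close>, and
    \<open>2 + 64 * (31 / 32) = 64\<close> closes the recursion. At \<open>k = n\<close> the
    exponents 3/8 and 1/8 add up to 1/2.\<close>
  define F where "F = (\<lambda>k::nat. 64 * c * real k powr (1 / 8))"
  have "\<exists>x\<in>{..<n} \<rightarrow>\<^sub>E {-1, 1}. \<forall>i<m. \<bar>\<Sum>j<n. a i j * x j\<bar> \<le> F (card {..<n})"
  proof (rule coloring_by_iteration[where R = "\<lambda>k. V * sqrt (real n * real k)"])
    fix k h :: nat
    assume k: "0 < k" "k \<le> card {..<n}" and h: "4 * h \<le> 3 * k"
    have "V * sqrt (real n * real k) * ln (50 * real m / real k)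
        \<le> V * sqrt (real n * real k) * (12 * l * (real n / real k) powr (1 / 4))"
      unfolding l_def using k nm V by (intro mult_left_mono ln_quotient_le_powr) auto
    also have "\<dots> = 12 * V * l * (sqrt (real n * real k) * (real n / real k) powr (1 / 4))"
      by simp
    also have "sqrt (real n * real k) * (real n / real k) powr (1 / 4)
        = (real n powr (3 / 8) * real k powr (1 / 8))\<^sup>2"
    proof -
      have "sqrt (real n * real k) * (real n / real k) powr (1 / 4)
          = (real n powr (1 / 2) * real n powr (1 / 4)) * (real k powr (1 / 2) / real k powr (1 / 4))"
        by (simp add: powr_divide powr_mult flip: powr_half_sqrt)
      also have "\<dots> = real n powr (3 / 4) * real k powr (1 / 4)"
        by (simp flip: powr_add powr_diff)
      also have "real n powr (3 / 4) = (real n powr (3 / 8))\<^sup>2"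
        by (simp add: power2_eq_square flip: powr_add)
      also have "real k powr (1 / 4) = (real k powr (1 / 8))\<^sup>2"
        by (simp add: power2_eq_square flip: powr_add)
      also have "(real n powr (3 / 8))\<^sup>2 * (real k powr (1 / 8))\<^sup>2
          = (real n powr (3 / 8) * real k powr (1 / 8))\<^sup>2"
        by (simp only: power_mult_distrib)
      finally show ?thesis .
    qed
    finally have "sqrt (V * sqrt (real n * real k) * ln (50 * real m / real k))
        \<le> sqrt (12 * V * l * (real n powr (3 / 8) * real k powr (1 / 8))\<^sup>2)"
      by (rule real_sqrt_le_mono)
    also have "\<dots> = c * real k powr (1 / 8)"
      by (simp add: real_sqrt_mult c_def)
    finally have 1: "sqrt (V * sqrt (real n * real k) * ln (50 * real m / real k))
        \<le> c * real k powr (1 / 8)" .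
    have "real h powr (1 / 8) \<le> (3 / 4 * real k) powr (1 / 8)"
      using h by (intro powr_mono2) auto
    also have "\<dots> = (3 / 4) powr (1 / 8) * real k powr (1 / 8)" by (rule powr_mult) 
    also have "\<dots> \<le> 31 / 32 * real k powr (1 / 8)"
      by (intro mult_right_mono three_quarters_powr_le) auto
    finally have "64 * c * real h powr (1 / 8) \<le> 64 * c * (31 / 32 * real k powr (1 / 8))"
      using c0 by (intro mult_left_mono) auto
    thus "2 * sqrt (V * sqrt (real n * real k) * ln (50 * real m / real k)) + F h \<le> F k"
      using 1 unfolding F_def by simp
  qed (use nm V rows c0 in \<open>auto simp: F_def\<close>)
  moreover have "F (card {..<n}) = 64 * sqrt (12 * V * (real n * l))"
  proof -
    have "F (card {..<n}) = 64 * (sqrt (12 * V * l) * (real n powr (3 / 8) * real n powr (1 / 8)))"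
      by (simp add: F_def c_def)
    also have "real n powr (3 / 8) * real n powr (1 / 8) = sqrt (real n)"
      by (simp flip: powr_add powr_half_sqrt)
    finally show ?thesis by (simp add: real_sqrt_mult mult_ac)
  qed
  ultimately show ?thesis by (simp only: l_def)
qed

section \<open>Fourth powers of sub-Gaussian rows\<close>

text \<open>Completing the square in \<open>t\<close> turns the integrand into a constant times the
  normal density with mean \<open>\<tau>^2 * x\<close>, whose integral is 1.\<close>

lemma nn_integral_exp_normal_density:
  assumes "0 < \<tau>"
  shows "(\<integral>\<^sup>+ t. ennreal (exp (t * x) * normal_density 0 \<tau> t) \<partial>lborel) = ennreal (exp (\<tau>\<^sup>2 * x\<^sup>2 / 2))"
proof -
  have "exp (t * x) * normal_density 0 \<tau> t = exp (\<tau>\<^sup>2 * x\<^sup>2 / 2) * normal_density (\<tau>\<^sup>2 * x) \<tau> t" for t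
  proof -
    have "t * x + - (t\<^sup>2 / (2 * \<tau>\<^sup>2)) = \<tau>\<^sup>2 * x\<^sup>2 / 2 + - ((t - \<tau>\<^sup>2 * x)\<^sup>2 / (2 * \<tau>\<^sup>2))"
      using assms by (simp add: field_simps power2_eq_square)
    hence "exp (t * x) * exp (- (t\<^sup>2 / (2 * \<tau>\<^sup>2)))
        = exp (\<tau>\<^sup>2 * x\<^sup>2 / 2) * exp (- ((t - \<tau>\<^sup>2 * x)\<^sup>2 / (2 * \<tau>\<^sup>2)))"
      by (simp only: flip: exp_add)
    thus ?thesis by (simp add: normal_density_def)
  qed
  hence "(\<integral>\<^sup>+ t. ennreal (exp (t * x) * normal_density 0 \<tau> t) \<partial>lborel)
      = (\<integral>\<^sup>+ t. ennreal (exp (\<tau>\<^sup>2 * x\<^sup>2 / 2)) * ennreal (normal_density (\<tau>\<^sup>2 * x) \<tau> t) \<partial>lborel)"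
    by (simp add: ennreal_mult)
  also have "\<dots> = ennreal (exp (\<tau>\<^sup>2 * x\<^sup>2 / 2)) * (\<integral>\<^sup>+ t. ennreal (normal_density (\<tau>\<^sup>2 * x) \<tau> t) \<partial>lborel)"
    by (rule nn_integral_cmult) simp
  also have "(\<integral>\<^sup>+ t. ennreal (normal_density (\<tau>\<^sup>2 * x) \<tau> t) \<partial>lborel) = 1"
    using assms by (simp add: nn_integral_eq_integral)
  finally show ?thesis by simp
qed

text \<open>
  The Gaussian moment generating function turns \<open>exp (Y\<^sup>2 / 4)\<close> into an average of
  \<open>exp (t * Y)\<close> over \<open>t\<close> with variance \<open>1 / 2\<close>.
\<close>

lemma (in prob_space) sub_gaussian_nn_integral_exp_square_le:
  assumes "sub_gaussian M X (\<sigma>\<^sup>2)" "0 < \<sigma>"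
  shows "(\<integral>\<^sup>+ \<omega>. ennreal (exp ((X \<omega> / \<sigma>)\<^sup>2 / 4)) \<partial>M) \<le> ennreal (sqrt 2)"
proof -
  let ?Y = "\<lambda>\<omega>. X \<omega> / \<sigma>"
  \<comment> \<open>Variance below 1 lets the density outweigh \<open>exp (t^2 / 2)\<close>; at 1/2
    their product is \<open>sqrt 2\<close> times the standard normal density.\<close>
  define \<tau> :: real where "\<tau> = 1 / sqrt 2"
  have \<tau>: "0 < \<tau>" "\<tau>\<^sup>2 = 1 / 2" by (auto simp: \<tau>_def power_divide)
  have X[measurable]: "X \<in> borel_measurable M"
    using assms by (auto simp: sub_gaussian_def)
  have mgf: "(\<integral>\<^sup>+ \<omega>. ennreal (exp (t * ?Y \<omega>)) \<partial>M) \<le> ennreal (exp (t\<^sup>2 / 2))" for t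
  proof -
    have i: "integrable M (\<lambda>\<omega>. exp ((t / \<sigma>) * X \<omega>))"
      and e: "(\<integral>\<omega>. exp ((t / \<sigma>) * X \<omega>) \<partial>M) \<le> exp (\<sigma>\<^sup>2 * (t / \<sigma>)\<^sup>2 / 2)"
      using assms unfolding sub_gaussian_def by blast+
    have "(\<integral>\<^sup>+ \<omega>. ennreal (exp (t * ?Y \<omega>)) \<partial>M) = ennreal (\<integral>\<omega>. exp ((t / \<sigma>) * X \<omega>) \<partial>M)"
      by (subst nn_integral_eq_integral[OF i, symmetric]) auto
    also have "\<dots> \<le> ennreal (exp (t\<^sup>2 / 2))"
      using e assms by (intro ennreal_leI) (simp add: power_divide)
    finally show ?thesis .
  qed
  have sf: "pair_sigma_finite M (lborel :: real measure)"
    by (simp add: pair_sigma_finite_def sigma_finite_measure_axioms sigma_finite_lborel)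
  have "(\<integral>\<^sup>+ \<omega>. ennreal (exp ((?Y \<omega>)\<^sup>2 / 4)) \<partial>M)
      = (\<integral>\<^sup>+ \<omega>. \<integral>\<^sup>+ t. ennreal (exp (t * ?Y \<omega>) * normal_density 0 \<tau> t) \<partial>lborel \<partial>M)"
    by (simp only: nn_integral_exp_normal_density[OF \<tau>(1)] \<tau>(2)) simp
  also have "\<dots> = (\<integral>\<^sup>+ t. \<integral>\<^sup>+ \<omega>. ennreal (exp (t * ?Y \<omega>) * normal_density 0 \<tau> t) \<partial>M \<partial>lborel)"
    by (rule pair_sigma_finite.Fubini'[OF sf, symmetric]) measurable
  also have "\<dots> = (\<integral>\<^sup>+ t. (\<integral>\<^sup>+ \<omega>. ennreal (exp (t * ?Y \<omega>)) \<partial>M) * ennreal (normal_density 0 \<tau> t) \<partial>lborel)"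
    by (simp add: ennreal_mult nn_integral_multc)
  also have "\<dots> \<le> (\<integral>\<^sup>+ t. ennreal (exp (t\<^sup>2 / 2)) * ennreal (normal_density 0 \<tau> t) \<partial>lborel)"
    by (intro nn_integral_mono mult_right_mono mgf) auto
  also have "\<dots> = (\<integral>\<^sup>+ t. ennreal (sqrt 2) * ennreal (normal_density 0 1 t) \<partial>lborel)"
  proof (intro nn_integral_cong)
    fix t :: real
    have "exp (t\<^sup>2 / 2) * normal_density 0 \<tau> t = sqrt 2 * normal_density 0 1 t"
      by (simp add: normal_density_def \<tau>(2) real_sqrt_mult field_simps flip: exp_add)
    thus "ennreal (exp (t\<^sup>2 / 2)) * ennreal (normal_density 0 \<tau> t) = ennreal (sqrt 2) * ennreal (normal_density 0 1 t)"
      by (simp flip: ennreal_mult)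
  qed
  also have "\<dots> = ennreal (sqrt 2) * (\<integral>\<^sup>+ t. ennreal (normal_density 0 1 t) \<partial>lborel)"
    by (rule nn_integral_cmult) simp
  also have "(\<integral>\<^sup>+ t. ennreal (normal_density 0 1 t) \<partial>lborel) = 1"
    by (simp add: nn_integral_eq_integral)
  finally show ?thesis by simp
qed

text \<open>
  The cap at \<open>y\<^sup>2\<close> keeps the exponential moments finite; below it, the fourth power gains
  the factor \<open>1 / sqrt n\<close> needed for \<open>n\<close> independent summands.
\<close>

definition capped_quartic :: "nat \<Rightarrow> real \<Rightarrow> real" where
  "capped_quartic n y = min (y ^ 4 / sqrt (real n)) (y\<^sup>2)"

lemma borel_measurable_capped_quartic [measurable]: "capped_quartic n \<in> borel_measurable borel"
  unfolding capped_quartic_def by measurable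

text \<open>For the quartic arm of the minimum this is an AM-GM estimate, for the quadratic arm it
  follows from \<open>k \<ge> 1\<close>. Summed over \<open>k\<close> columns, the last term
  contributes \<open>sqrt (n * k)\<close>, the order wanted for the row norms.\<close>

lemma square_le_capped_quartic:
  assumes "1 \<le> k" "k \<le> n"
  shows "y\<^sup>2 \<le> sqrt (real k) * capped_quartic n y + sqrt (real n) / sqrt (real k)"
proof -
  let ?N = "sqrt (real n)" and ?K = "sqrt (real k)"
  have K: "1 \<le> ?K" and N: "0 < ?N" using assms by auto
  have "y\<^sup>2 \<le> r * (y ^ 4 / t) + t / r" if "0 < r" "0 < t" for r t :: real
  proof -
    have "0 \<le> (r * y\<^sup>2 - t / 2)\<^sup>2 + 3 / 4 * t\<^sup>2" by simp
    also have "\<dots> = (r * (y ^ 4 / t) + t / r - y\<^sup>2) * (r * t)"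
      using that by (simp add: field_simps power2_eq_square power4_eq_xxxx)
    finally have "0 * (r * t) \<le> (r * (y ^ 4 / t) + t / r - y\<^sup>2) * (r * t)"
      by (simp only: mult_zero_left)
    hence "0 \<le> r * (y ^ 4 / t) + t / r - y\<^sup>2"
      by (rule mult_right_le_imp_le) (use that in simp)
    thus ?thesis by simp
  qed
  from this[of ?K ?N] have "y\<^sup>2 \<le> ?K * (y ^ 4 / ?N) + ?N / ?K" using K N by linarith
  moreover have "y\<^sup>2 \<le> ?K * y\<^sup>2 + ?N / ?K"
  proof -
    have "1 * y\<^sup>2 \<le> ?K * y\<^sup>2" using K by (rule mult_right_mono) simp
    moreover have "0 \<le> ?N / ?K" by simp
    ultimately show ?thesis by linarith
  qed
  ultimately show ?thesis
    unfolding capped_quartic_def min_def by simp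
qed

text \<open>In \<open>exp x \<le> 1 + x * exp x\<close> the quartic arm bounds the factor
  \<open>x\<close>, which gains \<open>1 / sqrt n\<close>, and the quadratic arm bounds the
  exponent. The remaining \<open>y ^ 4\<close> is absorbed by a further
  \<open>exp (y^2 / 8)\<close>.\<close>

lemma exp_capped_quartic_le:
  assumes "1 \<le> n"
  shows "exp (capped_quartic n y / 8) \<le> 1 + 16 / sqrt (real n) * exp (y\<^sup>2 / 4)"
proof -
  let ?N = "sqrt (real n)"
  have N: "0 < ?N" using assms by simp
  define x where "x = capped_quartic n y / 8"
  have x: "0 \<le> x" "x \<le> y ^ 4 / (8 * ?N)" "x \<le> y\<^sup>2 / 8"
    by (auto simp: x_def capped_quartic_def min_def)
  have "1 - x \<le> exp (- x)" using exp_ge_add_one_self[of "- x"] by simp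
  hence "(1 - x) * exp x \<le> exp (- x) * exp x" by (rule mult_right_mono) simp
  hence "exp x \<le> 1 + x * exp x" by (simp add: algebra_simps flip: exp_add)
  also have "x * exp x \<le> (y ^ 4 / (8 * ?N)) * exp (y\<^sup>2 / 8)"
    using x N by (intro mult_mono) auto
  also have "\<dots> \<le> (16 / ?N * exp (y\<^sup>2 / 8)) * exp (y\<^sup>2 / 8)"
  proof (intro mult_right_mono)
    have "1 + y\<^sup>2 / 8 + (y\<^sup>2 / 8)\<^sup>2 / 2 \<le> exp (y\<^sup>2 / 8)"
      by (rule exp_lower_Taylor_quadratic) simp
    moreover have "(y\<^sup>2 / 8)\<^sup>2 / 2 = y ^ 4 / 128"
      by (simp add: power_divide flip: power_mult)
    moreover have "0 \<le> y\<^sup>2" by simp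
    ultimately have "y ^ 4 \<le> 128 * exp (y\<^sup>2 / 8)" by linarith
    thus "y ^ 4 / (8 * ?N) \<le> 16 / ?N * exp (y\<^sup>2 / 8)" using N by (simp add: field_simps)
  qed simp
  also have "\<dots> = 16 / ?N * exp (y\<^sup>2 / 4)" by (simp flip: exp_add)
  finally show ?thesis by (simp add: x_def)
qed

text \<open>Integrating the pointwise bound gives \<open>1 + 16 * sqrt 2 / sqrt n\<close>, and
  \<open>16 * sqrt 2 \<le> 24\<close>. The exponential form multiplies to
  \<open>exp (24 * sqrt n)\<close> over \<open>n\<close> columns.\<close>

lemma (in prob_space) sub_gaussian_nn_integral_exp_capped_quartic_le:
  assumes "sub_gaussian M X (\<sigma>\<^sup>2)" "0 < \<sigma>" "1 \<le> n"
  shows "(\<integral>\<^sup>+ \<omega>. ennreal (exp (capped_quartic n (X \<omega> / \<sigma>) / 8)) \<partial>M) \<le> ennreal (exp (24 / sqrt (real n)))"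
proof -
  let ?c = "16 / sqrt (real n)"
  have X[measurable]: "X \<in> borel_measurable M"
    using assms by (auto simp: sub_gaussian_def)
  have plus: "ennreal (1 + c * e) = 1 + ennreal c * ennreal e" if "0 \<le> c" "0 \<le> e" for c e
    using that by (simp add: ennreal_mult)
  have "(\<integral>\<^sup>+ \<omega>. ennreal (exp (capped_quartic n (X \<omega> / \<sigma>) / 8)) \<partial>M)
      \<le> (\<integral>\<^sup>+ \<omega>. 1 + ennreal ?c * ennreal (exp ((X \<omega> / \<sigma>)\<^sup>2 / 4)) \<partial>M)"
  proof (intro nn_integral_mono)
    fix \<omega>
    have "ennreal (exp (capped_quartic n (X \<omega> / \<sigma>) / 8))
        \<le> ennreal (1 + ?c * exp ((X \<omega> / \<sigma>)\<^sup>2 / 4))"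
      by (intro ennreal_leI exp_capped_quartic_le) fact
    also have "\<dots> = 1 + ennreal ?c * ennreal (exp ((X \<omega> / \<sigma>)\<^sup>2 / 4))"
      by (rule plus) auto
    finally show "ennreal (exp (capped_quartic n (X \<omega> / \<sigma>) / 8))
        \<le> 1 + ennreal ?c * ennreal (exp ((X \<omega> / \<sigma>)\<^sup>2 / 4))" .
  qed
  also have "\<dots> = 1 + ennreal ?c * (\<integral>\<^sup>+ \<omega>. ennreal (exp ((X \<omega> / \<sigma>)\<^sup>2 / 4)) \<partial>M)"
    by (subst nn_integral_add) (auto simp: nn_integral_cmult emeasure_space_1)
  also have "\<dots> \<le> 1 + ennreal ?c * ennreal (sqrt 2)"
    by (intro add_left_mono mult_left_mono sub_gaussian_nn_integral_exp_square_le assms) auto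
  also have "\<dots> = ennreal (1 + ?c * sqrt 2)"
    by (rule plus[symmetric]) auto
  also have "\<dots> \<le> ennreal (exp (24 / sqrt (real n)))"
  proof (intro ennreal_leI)
    have "sqrt 2 \<le> 3 / 2" by (rule real_le_lsqrt) (auto simp: power2_eq_square)
    hence "?c * sqrt 2 \<le> ?c * (3 / 2)" by (intro mult_left_mono) auto
    hence "1 + ?c * sqrt 2 \<le> 1 + 24 / sqrt (real n)" by simp
    also have "\<dots> \<le> exp (24 / sqrt (real n))" by (rule exp_ge_add_one_self)
    finally show "1 + ?c * sqrt 2 \<le> exp (24 / sqrt (real n))" .
  qed
  finally show ?thesis .
qed

text \<open>Chernoff's bound with parameter 1/8: the threshold gives \<open>- 27 * sqrt n\<close> in
  the exponent, independence of the columns gives \<open>24 * sqrt n\<close>.\<close>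

lemma prob_sum_capped_quartic_gt:
  assumes D: "prob_space D" and X: "sub_gaussian D X (\<sigma>\<^sup>2)" and "0 < \<sigma>" "1 \<le> n"
  shows "measure (iid_columns n D) {a \<in> space (iid_columns n D).
           216 * sqrt (real n) < (\<Sum>j<n. capped_quartic n (X (a j) / \<sigma>))}
         \<le> exp (- 3 * sqrt (real n))"
proof -
  interpret D: prob_space D by fact
  interpret P: product_prob_space "\<lambda>_. D" "{..<n}" by unfold_locales
  let ?M = "iid_columns n D"
  let ?s = "\<lambda>a. \<Sum>j<n. capped_quartic n (X (a j) / \<sigma>)"
  have Xm[measurable]: "X \<in> borel_measurable D"
    using X by (auto simp: sub_gaussian_def)
  have [measurable]: "?s \<in> borel_measurable ?M" unfolding iid_columns_def by measurable
  let ?B = "{a \<in> space ?M. 216 * sqrt (real n) < ?s a}"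
  have "emeasure ?M ?B \<le> (\<integral>\<^sup>+ a. ennreal (exp (- 27 * sqrt (real n))) * ennreal (exp (?s a / 8)) \<partial>?M)"
  proof -
    have "emeasure ?M ?B = (\<integral>\<^sup>+ a. indicator ?B a \<partial>?M)" by simp
    also have "\<dots> \<le> (\<integral>\<^sup>+ a. ennreal (exp (- 27 * sqrt (real n))) * ennreal (exp (?s a / 8)) \<partial>?M)"
      by (intro nn_integral_mono) (auto simp: indicator_def simp flip: ennreal_mult exp_add)
    finally show ?thesis .
  qed
  also have "\<dots> = ennreal (exp (- 27 * sqrt (real n))) * (\<integral>\<^sup>+ a. ennreal (exp (?s a / 8)) \<partial>?M)"
    by (rule nn_integral_cmult) measurable
  also have "(\<integral>\<^sup>+ a. ennreal (exp (?s a / 8)) \<partial>?M)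
      = (\<integral>\<^sup>+ a. (\<Prod>j<n. ennreal (exp (capped_quartic n (X (a j) / \<sigma>) / 8))) \<partial>?M)"
    by (simp add: sum_divide_distrib exp_sum prod_ennreal)
  also have "\<dots> = (\<Prod>j<n. \<integral>\<^sup>+ v. ennreal (exp (capped_quartic n (X v / \<sigma>) / 8)) \<partial>D)"
    unfolding iid_columns_def by (rule P.product_nn_integral_prod) auto
  also have "\<dots> \<le> (\<Prod>j<n. ennreal (exp (24 / sqrt (real n))))"
    by (intro prod_mono_ennreal D.sub_gaussian_nn_integral_exp_capped_quartic_le assms)
  also have "\<dots> = ennreal (exp (24 / sqrt (real n)) ^ n)" by (simp add: ennreal_power)
  also have "exp (24 / sqrt (real n)) ^ n = exp (24 * (real n / sqrt (real n)))"
    by (simp flip: exp_of_nat_mult)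
  also have "real n / sqrt (real n) = sqrt (real n)" by (rule real_div_sqrt) simp
  also have "ennreal (exp (- 27 * sqrt (real n))) * ennreal (exp (24 * sqrt (real n)))
      = ennreal (exp (- 3 * sqrt (real n)))"
    by (simp flip: ennreal_mult exp_add)
  finally have "emeasure ?M ?B \<le> ennreal (exp (- 3 * sqrt (real n)))"
    by (simp add: mult_left_mono)
  thus ?thesis unfolding measure_def by (simp add: enn2real_leI)
qed

section \<open>The discrepancy bound\<close>

lemma disc_le_iff:
  assumes "0 < m"
  shows "disc m n A \<le> t \<longleftrightarrow> (\<exists>x\<in>{..<n} \<rightarrow>\<^sub>E {-1, 1}. \<forall>i<m. \<bar>mat_vec n A x i\<bar> \<le> t)"
proof -
  have "finite ({..<n} \<rightarrow>\<^sub>E {-1, 1::real})" by (intro finite_PiE) auto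
  moreover have "{..<n} \<rightarrow>\<^sub>E {-1, 1::real} \<noteq> {}" by (auto simp: PiE_eq_empty_iff)
  moreover have "sup_norm m y \<le> t \<longleftrightarrow> (\<forall>i<m. \<bar>y i\<bar> \<le> t)" for y
    unfolding sup_norm_def using assms by (subst Max_le_iff) auto
  ultimately show ?thesis unfolding disc_def by (subst Min_le_iff) auto
qed

text \<open>The event is a finite union over sign vectors of finite intersections over rows, and
  each row product is a finite combination of measurable entries.\<close>

lemma measurable_disc_le:
  assumes "0 < m" and D: "sets D = sets (\<Pi>\<^sub>M i\<in>{..<m}. (borel :: real measure))"
  shows "{a \<in> space (iid_columns n D). disc m n (matrix_of_columns a) \<le> t} \<in> sets (iid_columns n D)"
proof -
  have entry: "(\<lambda>a. a j i) \<in> borel_measurable (iid_columns n D)" if "i < m" "j < n" for i j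
  proof -
    have "(\<lambda>v. v i) \<in> borel_measurable D"
      using that by (subst measurable_cong_sets[OF D refl]) (auto intro: measurable_component_singleton)
    moreover have "(\<lambda>a. a j) \<in> measurable (iid_columns n D) D"
      unfolding iid_columns_def using that by (intro measurable_component_singleton) auto
    ultimately show ?thesis by (rule measurable_compose[rotated])
  qed
  have row: "(\<lambda>a. mat_vec n (matrix_of_columns a) x i) \<in> borel_measurable (iid_columns n D)"
    if "i < m" for x i
    unfolding mat_vec_def matrix_of_columns_def
    using entry[OF that] by (intro borel_measurable_sum borel_measurable_times) auto
  have "{a \<in> space (iid_columns n D). \<bar>mat_vec n (matrix_of_columns a) x i\<bar> \<le> t}
          \<in> sets (iid_columns n D)" if "i < m" for x i
    using row[OF that, of x] by measurable
  hence "{a \<in> space (iid_columns n D). \<forall>i\<in>{..<m}. \<bar>mat_vec n (matrix_of_columns a) x i\<bar> \<le> t}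
          \<in> sets (iid_columns n D)" for x
    by (intro sets.sets_Collect_finite_All) auto
  hence "{a \<in> space (iid_columns n D). \<exists>x\<in>{..<n} \<rightarrow>\<^sub>E {-1, 1}.
            \<forall>i\<in>{..<m}. \<bar>mat_vec n (matrix_of_columns a) x i\<bar> \<le> t} \<in> sets (iid_columns n D)"
    by (intro sets.sets_Collect_finite_Ex) (auto intro: finite_PiE)
  thus ?thesis using \<open>0 < m\<close> by (simp add: disc_le_iff Ball_def)
qed

text \<open>One inequality on the full row controls all subsets \<open>T\<close> at once, so no
  union bound over sets of columns arises. The constant is 216 from the row sum plus 1 from the
  additive term.\<close>

lemma sum_squares_le_of_capped_quartic:
  assumes "0 < \<sigma>" "T \<subseteq> {..<n}"
    and s: "(\<Sum>j<n. capped_quartic n (b j / \<sigma>)) \<le> 216 * sqrt (real n)"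
  shows "(\<Sum>j\<in>T. (b j)\<^sup>2) \<le> 217 * \<sigma>\<^sup>2 * sqrt (real n * real (card T))"
proof (cases "T = {}")
  case False
  have fin: "finite T" using assms(2) finite_subset by blast
  define k where "k = card T"
  have k: "1 \<le> k" "k \<le> n"
    using False fin assms(2) card_mono[of "{..<n}" T] by (auto simp: k_def card_gt_0_iff Suc_le_eq)
  have "(\<Sum>j\<in>T. (b j / \<sigma>)\<^sup>2)
      \<le> (\<Sum>j\<in>T. sqrt (real k) * capped_quartic n (b j / \<sigma>) + sqrt (real n) / sqrt (real k))"
    by (intro sum_mono square_le_capped_quartic k)
  also have "\<dots> = sqrt (real k) * (\<Sum>j\<in>T. capped_quartic n (b j / \<sigma>))
                   + sqrt (real n) * (real k / sqrt (real k))"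
    by (simp add: sum.distrib sum_distrib_left k_def)
  also have "real k / sqrt (real k) = sqrt (real k)" by (rule real_div_sqrt) simp
  also have "sqrt (real k) * (\<Sum>j\<in>T. capped_quartic n (b j / \<sigma>))
      \<le> sqrt (real k) * (216 * sqrt (real n))"
  proof (intro mult_left_mono)
    have "(\<Sum>j\<in>T. capped_quartic n (b j / \<sigma>)) \<le> (\<Sum>j<n. capped_quartic n (b j / \<sigma>))"
      using assms(2) by (intro sum_mono2) (auto simp: capped_quartic_def)
    thus "(\<Sum>j\<in>T. capped_quartic n (b j / \<sigma>)) \<le> 216 * sqrt (real n)" using s by linarith
  qed simp
  finally have "(\<Sum>j\<in>T. (b j / \<sigma>)\<^sup>2) \<le> 217 * sqrt (real n * real k)"
    by (simp add: real_sqrt_mult mult_ac)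
  hence "\<sigma>\<^sup>2 * (\<Sum>j\<in>T. (b j / \<sigma>)\<^sup>2) \<le> \<sigma>\<^sup>2 * (217 * sqrt (real n * real k))"
    by (rule mult_left_mono) simp
  moreover have "\<sigma>\<^sup>2 * (\<Sum>j\<in>T. (b j / \<sigma>)\<^sup>2) = (\<Sum>j\<in>T. (b j)\<^sup>2)"
    using assms(1) by (simp add: sum_distrib_left power_divide)
  ultimately show ?thesis by (simp add: k_def mult_ac)
qed simp

lemma disc_le_of_capped_quartic:
  assumes "1 \<le> n" "n \<le> m" "0 < \<sigma>"
    and s: "\<And>i. i < m \<Longrightarrow> (\<Sum>j<n. capped_quartic n (A i j / \<sigma>)) \<le> 216 * sqrt (real n)"
  shows "disc m n A \<le> 3328 * \<sigma> * sqrt (real n * ln (2 * real m / real n))"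
proof -
  let ?l = "real n * ln (2 * real m / real n)"
  have "\<exists>x\<in>{..<n} \<rightarrow>\<^sub>E {-1, 1}. \<forall>i<m. \<bar>\<Sum>j<n. A i j * x j\<bar> \<le> 64 * sqrt (12 * (217 * \<sigma>\<^sup>2) * ?l)"
  proof (rule coloring_of_regular_rows)
    fix i T assume "i < m" "T \<subseteq> {..<n}"
    thus "(\<Sum>j\<in>T. (A i j)\<^sup>2) \<le> 217 * \<sigma>\<^sup>2 * sqrt (real n * real (card T))"
      by (intro sum_squares_le_of_capped_quartic s assms)
  qed (use assms in auto)
  then obtain x where x: "x \<in> {..<n} \<rightarrow>\<^sub>E {-1, 1}"
    "\<And>i. i < m \<Longrightarrow> \<bar>\<Sum>j<n. A i j * x j\<bar> \<le> 64 * sqrt (12 * (217 * \<sigma>\<^sup>2) * ?l)"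
    by blast
  have "64 * sqrt (12 * (217 * \<sigma>\<^sup>2) * ?l) \<le> 3328 * \<sigma> * sqrt ?l"
  proof -
    have l0: "0 \<le> ?l" using assms by (intro mult_nonneg_nonneg ln_ge_zero) (auto simp: field_simps)
    \<comment> \<open>Numerically \<open>12 * 217 = 2604\<close> is at most
      \<open>52^2 = 2704\<close>, and \<open>64 * 52 = 3328\<close>.\<close>
    have "sqrt (12 * (217 * \<sigma>\<^sup>2) * ?l) \<le> sqrt ((52 * \<sigma>)\<^sup>2 * ?l)"
      using l0 by (intro real_sqrt_le_mono mult_right_mono) (auto simp: power_mult_distrib)
    also have "\<dots> = 52 * \<sigma> * sqrt ?l" using assms by (simp add: real_sqrt_mult)
    finally show ?thesis by simp
  qed
  hence "\<bar>mat_vec n A x i\<bar> \<le> 3328 * \<sigma> * sqrt ?l" if "i < m" for i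
    unfolding mat_vec_def using x(2)[OF that] by linarith
  with x(1) have "\<exists>x\<in>{..<n} \<rightarrow>\<^sub>E {-1, 1}. \<forall>i<m. \<bar>mat_vec n A x i\<bar> \<le> 3328 * \<sigma> * sqrt ?l"
    by blast
  moreover have "0 < m" using assms by simp
  ultimately show ?thesis by (simp only: disc_le_iff)
qed

text \<open>With variance 0 the generating functions at 1 and -1 are at most 1, so the nonnegative
  function \<open>exp X + exp (- X) - 2\<close> has integral 0. It vanishes only where
  \<open>X = 0\<close>.\<close>

lemma sub_gaussian_zero_AE:
  assumes "prob_space M" "sub_gaussian M X 0"
  shows "AE \<omega> in M. X \<omega> = 0"
proof -
  interpret prob_space M by fact
  have i: "integrable M (\<lambda>\<omega>. exp (s * X \<omega>))" and e: "(\<integral>\<omega>. exp (s * X \<omega>) \<partial>M) \<le> 1" for s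
    using assms(2) unfolding sub_gaussian_def by auto
  have i1: "integrable M (\<lambda>\<omega>. exp (X \<omega>))" and i2: "integrable M (\<lambda>\<omega>. exp (- X \<omega>))"
    using i[of 1] i[of "-1"] by auto
  let ?g = "\<lambda>\<omega>. exp (X \<omega>) + exp (- X \<omega>) - 2"
  have g0: "0 \<le> ?g \<omega>" for \<omega>
    using exp_ge_add_one_self[of "X \<omega>"] exp_ge_add_one_self[of "- X \<omega>"] by linarith
  have "(\<integral>\<omega>. ?g \<omega> \<partial>M) = (\<integral>\<omega>. exp (X \<omega>) \<partial>M) + (\<integral>\<omega>. exp (- X \<omega>) \<partial>M) - 2"
    using i1 i2 by (simp add: prob_space)
  also have "\<dots> \<le> 0" using e[of 1] e[of "-1"] by simp
  finally have "(\<integral>\<omega>. ?g \<omega> \<partial>M) = 0"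
    using Bochner_Integration.integral_nonneg[of M ?g] g0 by (intro antisym) auto
  hence "AE \<omega> in M. ?g \<omega> = 0"
    using i1 i2 g0 by (subst (asm) integral_nonneg_eq_0_iff_AE) auto
  thus ?thesis
  proof eventually_elim
    case (elim \<omega>)
    have "(exp (X \<omega>) - 1)\<^sup>2 = exp (X \<omega>) * ?g \<omega>"
      by (simp add: power2_eq_square algebra_simps flip: exp_add)
    thus ?case using elim by simp
  qed
qed

theorem theorem2:
  shows "\<exists>c>0. \<exists>C>0. \<forall>(m::nat) (n::nat) (D :: (nat \<Rightarrow> real) measure) (\<sigma>::real).
           1 \<le> n \<longrightarrow> n \<le> m \<longrightarrow> real m \<le> 2 powr (c * sqrt (real n)) \<longrightarrow>
           0 \<le> \<sigma> \<longrightarrow>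
           prob_space D \<longrightarrow> sets D = sets (\<Pi>\<^sub>M i\<in>{..<m}. (borel :: real measure)) \<longrightarrow>
           (\<forall>i<m. sub_gaussian D (\<lambda>v. v i) (\<sigma>\<^sup>2)) \<longrightarrow>
           \<P>(a in iid_columns n D.
               disc m n (matrix_of_columns a) \<le> C * \<sigma> * sqrt (real n * ln (2 * real m / real n)))
             \<ge> 1 - 1 / (real m)\<^sup>2"
proof (rule exI[of _ 1], rule conjI, simp, rule exI[of _ 3328], intro conjI allI impI)
  fix m n :: nat and D :: "(nat \<Rightarrow> real) measure" and \<sigma> :: real
  assume n: "1 \<le> n" and nm: "n \<le> m" and m: "real m \<le> 2 powr (1 * sqrt (real n))"
    and \<sigma>: "0 \<le> \<sigma>" and D: "prob_space D"
    and sets: "sets D = sets (\<Pi>\<^sub>M i\<in>{..<m}. (borel :: real measure))"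
    and sub: "\<forall>i<m. sub_gaussian D (\<lambda>v. v i) (\<sigma>\<^sup>2)"
  let ?M = "iid_columns n D"
  interpret D: prob_space D by fact
  interpret P: prob_space ?M
    unfolding iid_columns_def by (intro prob_space_PiM D)
  let ?t = "3328 * \<sigma> * sqrt (real n * ln (2 * real m / real n))"
  let ?G = "{a \<in> space ?M. disc m n (matrix_of_columns a) \<le> ?t}"
  have G[measurable]: "?G \<in> sets ?M" using n nm sets by (intro measurable_disc_le) auto
  show "1 - 1 / (real m)\<^sup>2 \<le> measure ?M ?G"
  \<comment> \<open>The tail estimate divides entries by \<open>\<sigma>\<close>. For
    \<open>\<sigma> = 0\<close> the matrix is almost surely zero and any sign vector attains the
    bound 0.\<close>
  proof (cases "\<sigma> = 0")
    case True
    have "AE a in ?M. \<forall>i\<in>{..<m}. \<forall>j\<in>{..<n}. a j i = 0"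
      unfolding iid_columns_def
      using sub True D by (intro AE_finite_allI AE_PiM_component sub_gaussian_zero_AE) auto
    hence "AE a in ?M. disc m n (matrix_of_columns a) \<le> ?t"
    proof eventually_elim
      case (elim a)
      obtain x :: "nat \<Rightarrow> real" where "x \<in> {..<n} \<rightarrow>\<^sub>E {-1, 1}"
        by (metis PiE_eq_empty_iff ex_in_conv insert_not_empty)
      moreover have "\<forall>i<m. \<bar>mat_vec n (matrix_of_columns a) x i\<bar> \<le> ?t"
        using elim True by (simp add: mat_vec_def matrix_of_columns_def)
      ultimately show ?case using n nm by (subst disc_le_iff) auto
    qed
    hence "measure ?M ?G = 1" using G by (subst P.prob_Collect_eq_1) auto
    thus ?thesis by simp
  next
    case False
    hence s0: "0 < \<sigma>" using \<sigma> by simp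
    \<comment> \<open>\<open>B i\<close> is the event that row \<open>i\<close> is irregular; off
      the union of these events the coloring argument is deterministic.\<close>
    define B where "B = (\<lambda>i. {a \<in> space ?M.
      216 * sqrt (real n) < (\<Sum>j<n. capped_quartic n (a j i / \<sigma>))})"
    have B[measurable]: "B i \<in> sets ?M" if "i < m" for i
    proof -
      have [measurable]: "(\<lambda>v. v i) \<in> borel_measurable D"
        using sub that by (auto simp: sub_gaussian_def)
      show ?thesis unfolding B_def iid_columns_def by measurable
    qed
    have "measure ?M (\<Union>i<m. B i) \<le> (\<Sum>i<m. measure ?M (B i))"
      using B by (intro measure_UNION_le) auto
    also have "\<dots> \<le> (\<Sum>i<m. exp (- 3 * sqrt (real n)))"
      unfolding B_def using sub D n s0 by (intro sum_mono prob_sum_capped_quartic_gt) auto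
    also have "\<dots> = real m * exp (- 3 * sqrt (real n))" by simp
    \<comment> \<open>With \<open>c = 1\<close>,
      \<open>m \<le> 2 powr sqrt n \<le> exp (sqrt n)\<close>. Of the resulting
      \<open>m ^ 3\<close>, one factor pays for the union over rows and two give the stated
      probability.\<close>
    also have "\<dots> \<le> 1 / (real m)\<^sup>2"
    proof -
      have "real m \<le> exp (sqrt (real n) * ln 2)" using m by (simp add: powr_def)
      also have "\<dots> \<le> exp (sqrt (real n) * 1)"
        using ln_2_less_1 by (intro exp_le_cancel_iff[THEN iffD2] mult_left_mono) auto
      finally have "real m ^ 3 \<le> exp (sqrt (real n)) ^ 3" by (intro power_mono) auto
      also have "\<dots> = exp (3 * sqrt (real n))" by (simp flip: exp_of_nat_mult)
      finally have "real m ^ 3 * exp (- 3 * sqrt (real n)) \<le> 1"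
        by (simp add: exp_minus field_simps)
      thus ?thesis using n nm by (simp add: field_simps power2_eq_square power3_eq_cube)
    qed
    finally have bad: "measure ?M (\<Union>i<m. B i) \<le> 1 / (real m)\<^sup>2" .
    have "space ?M - (\<Union>i<m. B i) \<subseteq> ?G"
      using n nm s0 by (auto simp: B_def not_less matrix_of_columns_def intro!: disc_le_of_capped_quartic)
    hence "measure ?M (space ?M - (\<Union>i<m. B i)) \<le> measure ?M ?G"
      using G by (rule P.finite_measure_mono)
    moreover have "measure ?M (space ?M - (\<Union>i<m. B i)) = 1 - measure ?M (\<Union>i<m. B i)"
      using B by (intro P.prob_compl) auto
    ultimately show ?thesis using bad by linarith
  qed
qed simp

end
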